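(* Let $r\ge0$ be an integer, and let $\mu_r,\mu'_r\in\mathbb{C}$ with $\mu_r\ne\mu'_r$, $\mu_r\ne0$, $\mu'_r\ne0$. (1) $P^t_n(\mu_r;r)=P_n$ for $0\le n\le r$, and $P^t_n(\mu_r;r)(x)=P_n(x)-\mu_rP_r(x)P_{n-r-1}(x)$ for $n\ge r+1$. For $n\ge r+1$, consider the three polynomials $P^t_n(\mu_r;r)$, $P^t_n(\mu'_r;r)$, $P_n$, and their interception points and common zeros. Then: (2) The three polynomials intersect each other at the zeros of $P_r$ and at the zeros of $P_{n-r-1}$ (i.e. the interception points are the zeros of $P_r$ and the zeros of $P_{n-r-1}$). (3) $\xi$ is a double interception point if and only if $\xi$ is a common zero of $P_r$ and $P_{n-r-1}$. (4) For $n=i(r+1)+r$ with $i\ge1$, $r\ge1$, all zeros of $P_r$ are double interception points, and the number of distinct interception points is $n-r-1$. (5) If $r$ is even: if $n$ is even, then the origin is a simple interception point; if $n$ is odd, then the origin is not an interception point. If $r$ is odd: if $n$ is even, then the origin is a simple interception point; if $n$ is odd, then the origin is a double interception point. (6) $\xi$ is a common zero of the three polynomials if and only if $\xi$ is a common zero of $P_n$ and $P_r$ or $\xi$ is a common zero of $P_n$ and $P_{n-r-1}$. (7) $\xi$ is a double common zero of the three polynomials if and only if $\xi$ is a common zero of $P_r$, $P_n$ and $P_{n-r-1}$. (8) For $n=i(r+1)+r$ with $i\ge1$, $r\ge1$, all zeros of $P_r$ are double common zeros of the three polynomials. (9) If $n$ and $r$ are odd, then the origin is a double common zero of the three polynomials.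 If $n$ is odd and $r$ is even, or if $n$ is even, then the origin is not a common zero of the three polynomials.
   Context: $\{P_n\}_{n\ge0}$ denotes the monic Chebyshev polynomials of the second kind: $P_0=1$, $P_1=x$, $P_{n+2}(x)=xP_{n+1}(x)-\frac14P_n(x)$ for $n\ge 0$. For an integer $r\ge 0$ and $\mu_r\in\mathbb{C}$, the $r$th-perturbed sequence by translation $\{P^t_n(\mu_r;r)\}_{n\ge 0}$ is the monic sequence with $P^t_0=1$, $P^t_1(x)=x-\beta_0$, $P^t_{n+2}(x)=(x-\beta_{n+1})P^t_{n+1}(x)-\frac14P^t_n(x)$ for $n\ge 0$, where $\beta_r=\mu_r$ and $\beta_n=0$ for $n\ne r$. An interception point of several polynomials is a point $\xi$ at which they all take the same value; it is double if moreover all their first derivatives agree at $\xi$ (i.e. each pairwise difference and its derivative vanish at $\xi$), and simple otherwise. A common zero is a point where all the polynomials vanish; a double common zero is a common zero which is also a double interception point (it need not be a multiple zero of the individual polynomials). *)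

theory Defs
  imports Complex_Main "HOL-Computational_Algebra.Polynomial"
begin

text \<open>Monic Chebyshev polynomials of the second kind: \<open>cheb n\<close> is \<open>U\<^sub>n / 2 ^ n\<close>.\<close>

fun cheb :: "nat \<Rightarrow> complex poly" where
  "cheb 0 = 1"
| "cheb (Suc 0) = [:0, 1:]"
| "cheb (Suc (Suc n)) = [:0, 1:] * cheb (Suc n) - smult (1/4) (cheb n)"

definition transl_coeff :: "complex \<Rightarrow> nat \<Rightarrow> nat \<Rightarrow> complex" where
  "transl_coeff \<mu> r n = (if n = r then \<mu> else 0)"

fun cheb_transl :: "complex \<Rightarrow> nat \<Rightarrow> nat \<Rightarrow> complex poly" where
  "cheb_transl \<mu> r 0 = 1"
| "cheb_transl \<mu> r (Suc 0) = [:- transl_coeff \<mu> r 0, 1:]"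
| "cheb_transl \<mu> r (Suc (Suc n)) =
     [:- transl_coeff \<mu> r (Suc n), 1:] * cheb_transl \<mu> r (Suc n)
       - smult (1/4) (cheb_transl \<mu> r n)"

definition interception_point :: "complex poly set \<Rightarrow> complex \<Rightarrow> bool" where
  "interception_point F \<xi> \<longleftrightarrow> (\<forall>p\<in>F. \<forall>q\<in>F. poly p \<xi> = poly q \<xi>)"

definition double_interception_point :: "complex poly set \<Rightarrow> complex \<Rightarrow> bool" where
  "double_interception_point F \<xi> \<longleftrightarrow>
     interception_point F \<xi> \<and> (\<forall>p\<in>F. \<forall>q\<in>F. poly (pderiv p) \<xi> = poly (pderiv q) \<xi>)"

definition simple_interception_point :: "complex poly set \<Rightarrow> complex \<Rightarrow> bool" where
  "simple_interception_point F \<xi> \<longleftrightarrow>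
     interception_point F \<xi> \<and> \<not> double_interception_point F \<xi>"

definition common_zero :: "complex poly set \<Rightarrow> complex \<Rightarrow> bool" where
  "common_zero F \<xi> \<longleftrightarrow> (\<forall>p\<in>F. poly p \<xi> = 0)"

text \<open>``Double'' refers to the contact between the members of \<open>F\<close>; the members themselves
  may have a simple zero at the point.\<close>

definition double_common_zero :: "complex poly set \<Rightarrow> complex \<Rightarrow> bool" where
  "double_common_zero F \<xi> \<longleftrightarrow> common_zero F \<xi> \<and> double_interception_point F \<xi>"

definition three_polys :: "complex \<Rightarrow> complex \<Rightarrow> nat \<Rightarrow> nat \<Rightarrow> complex poly set" where
  "three_polys \<mu> \<mu>' r n = {cheb_transl \<mu> r n, cheb_transl \<mu>' r n, cheb n}"

end

(*
  Subtracting recurrences gives (1), so all pairwise differences of the three polynomials are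
  nonzero multiples of P_r P_{n-r-1}.  Everything then reduces to three facts about the P_n: their
  zeros are simple, since (x^2 - 1) P_{n+1}' = (n+1) x P_{n+1} - (n+2)/2 P_n would force a multiple
  zero to be shared by two consecutive P's; P_r divides P_{i(r+1)+r}, by the addition formula
  P_{m+n+2} = P_{m+1} P_{n+1} - P_m P_n / 4; and P_n(0) = 0 iff n is odd.
*)

theory Submission
  imports Defs "HOL-Computational_Algebra.Fundamental_Theorem_Algebra"
begin

lemma cheb_transl_le: "n \<le> r \<Longrightarrow> cheb_transl \<mu> r n = cheb n"
  by (induction n rule: cheb.induct) (auto simp: transl_coeff_def)

text \<open>Past index \<open>r\<close> both sides obey the unperturbed recurrence in
  \<open>k\<close>, so two base cases suffice. The form \<open>Suc (r + k)\<close> avoids truncated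
  subtraction.\<close>

lemma cheb_transl_gt:
  "cheb_transl \<mu> r (Suc (r + k)) = cheb (Suc (r + k)) - smult \<mu> (cheb r * cheb k)"
proof -
  \<comment> \<open>The perturbation enters here: through the clause for \<open>Suc 0\<close> if
    \<open>r = 0\<close>, through the recursive clause otherwise.\<close>
  have first: "cheb_transl \<mu> r (Suc r) = cheb (Suc r) - smult \<mu> (cheb r)"
    by (cases r) (simp_all add: transl_coeff_def cheb_transl_le algebra_simps)
  show ?thesis
  proof (induction k rule: cheb.induct)
    case 1
    show ?case using first by simp
  next
    case 2
    show ?case
      using first cheb_transl_le[of r r \<mu>] by (simp add: transl_coeff_def algebra_simps
          smult_diff_right)
  next
    case (3 k)
    have "cheb_transl \<mu> r (Suc (r + Suc (Suc k))) =
        [:0, 1:] * cheb_transl \<mu> r (Suc (r + Suc k)) - smult (1/4) (cheb_transl \<mu> r (Suc (r + k)))"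
      by (simp add: transl_coeff_def)
    also have "\<dots> = cheb (Suc (r + Suc (Suc k))) - smult \<mu> (cheb r * cheb (Suc (Suc k)))"
      unfolding 3 by (simp add: algebra_simps smult_diff_right smult_add_right)
    finally show ?case .
  qed
qed

lemma degree_cheb: "degree (cheb n) = n \<and> cheb n \<noteq> 0"
proof (induction n rule: cheb.induct)
  case (3 n)
  have "degree (cheb (Suc (Suc n))) = degree ([:0, 1:] * cheb (Suc n))"
    unfolding cheb.simps diff_conv_add_uminus
    by (rule degree_add_eq_left) (use 3 in \<open>simp add: degree_mult_eq del: cheb.simps\<close>)
  also have "\<dots> = Suc (Suc n)"
    using 3 by (simp add: degree_mult_eq del: cheb.simps)
  finally show ?case
    by (metis Zero_not_Suc degree_0)
qed auto

text \<open>Read backwards, the recurrence would carry a zero shared by two neighbours down to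
  \<open>cheb 0 = 1\<close>.\<close>

lemma cheb_consecutive_no_common_zero:
  "poly (cheb n) x = 0 \<Longrightarrow> poly (cheb (Suc n)) x \<noteq> 0"
  by (induction n) auto

text \<open>The classical relation \<open>(x^2 - 1) U_k' = k x U_k - (k + 1) U_(k-1)\<close> at
  \<open>k = n + 1\<close>, divided by \<open>2 ^ (n + 1)\<close>; the rescaling produces the factor
  1/2.\<close>

lemma pderiv_cheb_Suc:
  "(x\<^sup>2 - 1) * poly (pderiv (cheb (Suc n))) x =
     of_nat (n + 1) * x * poly (cheb (Suc n)) x - of_nat (n + 2) / 2 * poly (cheb n) x"
proof (induction n rule: cheb.induct)
  case 1
  show ?case by (simp add: pderiv_pCons power2_eq_square)
next
  case 2
  show ?case
    by (simp add: pderiv_pCons pderiv_diff pderiv_mult pderiv_smult power2_eq_square algebra_simps)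
next
  case (3 n)
  let ?p = "\<lambda>k. poly (cheb k) x" and ?d = "\<lambda>k. poly (pderiv (cheb k)) x"
  have d: "?d (Suc (Suc (Suc n))) = ?p (Suc (Suc n)) + x * ?d (Suc (Suc n)) - ?d (Suc n) / 4"
    by (simp add: pderiv_pCons pderiv_diff pderiv_mult pderiv_smult)
  have p: "?p (Suc (Suc k)) = x * ?p (Suc k) - ?p k / 4" for k
    by simp
  \<comment> \<open>The factor \<open>x^2 - 1\<close> gives both derivative terms the shape of the
    induction hypotheses, so that only values of \<open>cheb\<close> remain.\<close>
  have "(x\<^sup>2 - 1) * ?d (Suc (Suc (Suc n))) =
      (x\<^sup>2 - 1) * ?p (Suc (Suc n)) + x * ((x\<^sup>2 - 1) * ?d (Suc (Suc n)))
        - (x\<^sup>2 - 1) * ?d (Suc n) / 4"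
    unfolding d by (simp add: algebra_simps)
  then show ?case
    unfolding 3 by (simp add: p power2_eq_square algebra_simps add_divide_distrib
        diff_divide_distrib del: cheb.simps)
qed

text \<open>At a zero, the right-hand side of \<open>pderiv_cheb_Suc\<close> is a nonzero multiple
  of the preceding polynomial's value, so the left-hand side cannot vanish. The points 1 and -1 need
  no separate treatment.\<close>

lemma pderiv_cheb_nonzero:
  assumes "poly (cheb n) x = 0"
  shows "poly (pderiv (cheb n)) x \<noteq> 0"
proof (cases n)
  case 0
  with assms show ?thesis by simp
next
  case (Suc m)
  have "poly (cheb m) x \<noteq> 0"
    using cheb_consecutive_no_common_zero assms Suc by blast
  moreover have "of_nat (m + 2) \<noteq> (0 :: complex)"
    unfolding of_nat_eq_0_iff by simp
  ultimately show ?thesis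
    using pderiv_cheb_Suc[of x m] assms Suc by auto
qed

text \<open>Over the complex numbers such a polynomial is a constant times the product of
  \<open>[:- z, 1:]\<close> over its distinct roots.\<close>

lemma card_zeros_rsquarefree:
  fixes p :: "complex poly"
  assumes "rsquarefree p"
  shows "card {x. poly p x = 0} = degree p"
proof -
  have p: "p \<noteq> 0"
    using assms by (simp add: rsquarefree_def)
  have "degree p = degree (\<Prod>z | poly p z = 0. [:-z, 1:])"
    using complex_poly_decompose_rsquarefree[OF assms] p
    by (metis degree_smult_eq leading_coeff_0_iff)
  also have "\<dots> = card {z. poly p z = 0}"
    by (subst degree_prod_sum_eq) simp_all
  finally show ?thesis ..
qed

lemma card_zeros_cheb: "card {x. poly (cheb n) x = 0} = n"
  using card_zeros_rsquarefree[of "cheb n"] degree_cheb pderiv_cheb_nonzero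
  by (auto simp: rsquarefree_roots)

text \<open>For fixed \<open>n\<close> both sides satisfy the Chebyshev recurrence in
  \<open>m\<close>.\<close>

lemma cheb_add:
  "cheb (Suc (Suc (m + n))) = cheb (Suc m) * cheb (Suc n) - smult (1/4) (cheb m * cheb n)"
proof (induction m rule: cheb.induct)
  case (3 m)
  have "cheb (Suc (Suc (Suc (Suc m) + n))) =
      [:0, 1:] * cheb (Suc (Suc (Suc m + n))) - smult (1/4) (cheb (Suc (Suc (m + n))))"
    by simp
  also have "\<dots> = cheb (Suc (Suc (Suc m))) * cheb (Suc n) - smult (1/4) (cheb (Suc (Suc m)) * cheb n)"
    unfolding 3 by (simp add: algebra_simps smult_diff_right smult_add_right)
  finally show ?case .
qed (simp_all add: algebra_simps smult_diff_right)

text \<open>With indices shifted by one, this is the case where \<open>r + 1\<close> divides the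
  other index. The addition formula advances \<open>i\<close> by one.\<close>

lemma cheb_dvd: "cheb r dvd cheb (i * (r + 1) + r)"
proof (induction i)
  case (Suc i)
  show ?case
  proof (cases r)
    case (Suc s)
    \<comment> \<open>Chosen so that \<open>Suc a\<close> is the index in the induction hypothesis,
      which takes \<open>r\<close> positive; for \<open>r = 0\<close> the divisor is 1.\<close>
    define a where "a = i * (r + 1) + s"
    have "cheb (Suc i * (r + 1) + r) = cheb (Suc (Suc (r + a)))"
      unfolding a_def Suc by (rule arg_cong[of _ _ cheb]) simp
    also have "\<dots> = cheb (Suc r) * cheb (Suc a) - smult (1/4) (cheb r * cheb a)"
      by (rule cheb_add)
    also have "cheb r dvd \<dots>"
      using Suc.IH \<open>r = Suc s\<close> by (intro dvd_diff dvd_smult) (auto simp: a_def simp del: cheb.simps)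
    finally show ?thesis .
  qed simp
qed simp

text \<open>At 0 the recurrence becomes multiplication by -1/4 with index step 2, starting from the
  values 1 and 0.\<close>

lemma cheb_origin: "poly (cheb n) 0 = 0 \<longleftrightarrow> odd n"
  by (induction n rule: cheb.induct) auto

text \<open>The three values are \<open>P_n(x) - c v\<close> with \<open>v = P_r(x) P_m(x)\<close>
  and \<open>c\<close> one of the distinct numbers 0, \<open>\<mu>\<close>, \<open>\<mu>'\<close>;
  they agree exactly when \<open>v = 0\<close>.\<close>

lemma interception_three_polys:
  assumes "\<mu> \<noteq> \<mu>'" "\<mu> \<noteq> 0" "\<mu>' \<noteq> 0" and n: "n = Suc (r + m)"
  shows "interception_point (three_polys \<mu> \<mu>' r n) x \<longleftrightarrow>
    poly (cheb r) x = 0 \<or> poly (cheb m) x = 0"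
  unfolding n interception_point_def three_polys_def cheb_transl_gt using assms(1-3)
  by (auto simp del: cheb.simps)

text \<open>Contact is double when the product \<open>P_r P_m\<close> has a multiple zero. Each
  factor has simple zeros, so both must vanish.\<close>

lemma double_interception_three_polys:
  assumes "\<mu> \<noteq> \<mu>'" "\<mu> \<noteq> 0" "\<mu>' \<noteq> 0" and n: "n = Suc (r + m)"
  shows "double_interception_point (three_polys \<mu> \<mu>' r n) x \<longleftrightarrow>
    poly (cheb r) x = 0 \<and> poly (cheb m) x = 0"
proof -
  have "(\<forall>p\<in>three_polys \<mu> \<mu>' r n. \<forall>q\<in>three_polys \<mu> \<mu>' r n.
        poly (pderiv p) x = poly (pderiv q) x) \<longleftrightarrow> poly (pderiv (cheb r * cheb m)) x = 0"
    unfolding n three_polys_def cheb_transl_gt using assms(1-3)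
    by (auto simp: pderiv_diff pderiv_smult simp del: cheb.simps)
  then show ?thesis
    unfolding double_interception_point_def interception_three_polys[OF assms]
    using pderiv_cheb_nonzero[of r x] pderiv_cheb_nonzero[of m x]
    by (auto simp: pderiv_mult simp del: cheb.simps)
qed

text \<open>\<open>cheb n\<close> is itself a member; once it vanishes, the member for
  \<open>\<mu>\<close> vanishes only if the product does.\<close>

lemma common_zero_three_polys:
  assumes "\<mu> \<noteq> 0" and n: "n = Suc (r + m)"
  shows "common_zero (three_polys \<mu> \<mu>' r n) x \<longleftrightarrow>
    poly (cheb n) x = 0 \<and> (poly (cheb r) x = 0 \<or> poly (cheb m) x = 0)"
  unfolding n common_zero_def three_polys_def cheb_transl_gt using assms(1)
  by (auto simp del: cheb.simps)

theorem proposition5p8: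
  fixes r :: nat and \<mu> \<mu>' :: complex
  assumes "\<mu> \<noteq> \<mu>'" and "\<mu> \<noteq> 0" and "\<mu>' \<noteq> 0"
  shows
    "((\<forall>n\<le>r. cheb_transl \<mu> r n = cheb n) \<and>
       (\<forall>n\<ge>r + 1. cheb_transl \<mu> r n = cheb n - smult \<mu> (cheb r * cheb (n - r - 1)))) \<and>
     (\<forall>n\<ge>r + 1.
         {\<xi>. interception_point (three_polys \<mu> \<mu>' r n) \<xi>} =
           {\<xi>. poly (cheb r) \<xi> = 0} \<union> {\<xi>. poly (cheb (n - r - 1)) \<xi> = 0}) \<and>
     (\<forall>n\<ge>r + 1. \<forall>\<xi>.
         double_interception_point (three_polys \<mu> \<mu>' r n) \<xi> \<longleftrightarrow>
           common_zero {cheb r, cheb (n - r - 1)} \<xi>) \<and>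
     (\<forall>n i. n = i * (r + 1) + r \<and> i \<ge> 1 \<and> r \<ge> 1 \<longrightarrow>
         (\<forall>\<xi>. poly (cheb r) \<xi> = 0 \<longrightarrow>
            double_interception_point (three_polys \<mu> \<mu>' r n) \<xi>) \<and>
         card {\<xi>. interception_point (three_polys \<mu> \<mu>' r n) \<xi>} = n - r - 1) \<and>
     (\<forall>n\<ge>r + 1.
         (even r \<and> even n \<longrightarrow> simple_interception_point (three_polys \<mu> \<mu>' r n) 0) \<and>
         (even r \<and> odd n \<longrightarrow> \<not> interception_point (three_polys \<mu> \<mu>' r n) 0) \<and>
         (odd r \<and> even n \<longrightarrow> simple_interception_point (three_polys \<mu> \<mu>' r n) 0) \<and>
         (odd r \<and> odd n \<longrightarrow> double_interception_point (three_polys \<mu> \<mu>' r n) 0)) \<and>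
     (\<forall>n\<ge>r + 1. \<forall>\<xi>.
         common_zero (three_polys \<mu> \<mu>' r n) \<xi> \<longleftrightarrow>
           common_zero {cheb n, cheb r} \<xi> \<or> common_zero {cheb n, cheb (n - r - 1)} \<xi>) \<and>
     (\<forall>n\<ge>r + 1. \<forall>\<xi>.
         double_common_zero (three_polys \<mu> \<mu>' r n) \<xi> \<longleftrightarrow>
           common_zero {cheb r, cheb n, cheb (n - r - 1)} \<xi>) \<and>
     (\<forall>n i. n = i * (r + 1) + r \<and> i \<ge> 1 \<and> r \<ge> 1 \<longrightarrow>
         (\<forall>\<xi>. poly (cheb r) \<xi> = 0 \<longrightarrow> double_common_zero (three_polys \<mu> \<mu>' r n) \<xi>)) \<and>
     (\<forall>n\<ge>r + 1.
         (odd n \<and> odd r \<longrightarrow> double_common_zero (three_polys \<mu> \<mu>' r n) 0) \<and>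
         ((odd n \<and> even r) \<or> even n \<longrightarrow> \<not> common_zero (three_polys \<mu> \<mu>' r n) 0))"
proof -
  note interception = interception_three_polys[OF assms]
  note double = double_interception_three_polys[OF assms]
  note zero = common_zero_three_polys[OF assms(2)]
  have n: "n = Suc (r + (n - r - 1))" if "n \<ge> r + 1" for n
    using that by simp
  have p1: "\<forall>n\<le>r. cheb_transl \<mu> r n = cheb n"
    by (simp add: cheb_transl_le)
  have p1': "\<forall>n\<ge>r + 1. cheb_transl \<mu> r n = cheb n - smult \<mu> (cheb r * cheb (n - r - 1))"
    using n cheb_transl_gt by metis
  have roots: "poly (cheb r) x = 0 \<Longrightarrow> poly (cheb (i * (r + 1) + r)) x = 0" for i x
    using cheb_dvd[of r i] by (metis dvd_trans poly_eq_0_iff_dvd)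
  have p4: "(\<forall>x. poly (cheb r) x = 0 \<longrightarrow>
        double_interception_point (three_polys \<mu> \<mu>' r n) x \<and>
        double_common_zero (three_polys \<mu> \<mu>' r n) x) \<and>
      card {x. interception_point (three_polys \<mu> \<mu>' r n) x} = n - r - 1"
    if "n = i * (r + 1) + r \<and> i \<ge> 1 \<and> r \<ge> 1" for n i
  proof -
    from that obtain j where i: "i = Suc j"
      by (auto simp: Suc_le_eq gr0_conv_Suc)
    \<comment> \<open>Here \<open>n - r - 1\<close> has the same form as \<open>n\<close>, with
      \<open>j\<close> for \<open>i\<close>, so \<open>cheb r\<close> divides
      \<open>cheb (n - r - 1)\<close> too.\<close>
    have n: "n = Suc (r + (j * (r + 1) + r))"
      using that i by simp
    \<comment> \<open>The zeros of \<open>cheb r\<close> are absorbed, so the count is the number of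
      zeros of a single \<open>cheb\<close>.\<close>
    have "{x. interception_point (three_polys \<mu> \<mu>' r n) x} =
        {x. poly (cheb (j * (r + 1) + r)) x = 0}"
      using interception[OF n] roots by auto
    moreover have "poly (cheb r) x = 0 \<Longrightarrow> poly (cheb n) x = 0" for x
      using roots[of x i] that by simp
    moreover have "card {x. poly (cheb (j * (r + 1) + r)) x = 0} = n - r - 1"
      unfolding card_zeros_cheb n by simp
    ultimately show ?thesis
      unfolding double_common_zero_def double[OF n] zero[OF n]
      using roots[of _ j] by presburger
  qed
  \<comment> \<open>Together with \<open>cheb_origin\<close>, this settles every claim about the
    origin by parity alone.\<close>
  have parity: "even (n - r - 1) \<longleftrightarrow> even n \<noteq> even r" if "n \<ge> r + 1" for n
    using n[OF that] by presburger
  have p2: "\<forall>n\<ge>r + 1. {\<xi>. interception_point (three_polys \<mu> \<mu>' r n) \<xi>} =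
      {\<xi>. poly (cheb r) \<xi> = 0} \<union> {\<xi>. poly (cheb (n - r - 1)) \<xi> = 0}"
    using interception[OF n] by auto
  have p3: "\<forall>n\<ge>r + 1. \<forall>\<xi>. double_interception_point (three_polys \<mu> \<mu>' r n) \<xi> \<longleftrightarrow>
      common_zero {cheb r, cheb (n - r - 1)} \<xi>"
    using double[OF n] by (simp add: common_zero_def)
  have p5: "\<forall>n\<ge>r + 1.
      (even r \<and> even n \<longrightarrow> simple_interception_point (three_polys \<mu> \<mu>' r n) 0) \<and>
      (even r \<and> odd n \<longrightarrow> \<not> interception_point (three_polys \<mu> \<mu>' r n) 0) \<and>
      (odd r \<and> even n \<longrightarrow> simple_interception_point (three_polys \<mu> \<mu>' r n) 0) \<and>
      (odd r \<and> odd n \<longrightarrow> double_interception_point (three_polys \<mu> \<mu>' r n) 0)"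
    unfolding simple_interception_point_def
    using interception[OF n] double[OF n] parity by (simp add: cheb_origin)
  have p6: "\<forall>n\<ge>r + 1. \<forall>\<xi>. common_zero (three_polys \<mu> \<mu>' r n) \<xi> \<longleftrightarrow>
      common_zero {cheb n, cheb r} \<xi> \<or> common_zero {cheb n, cheb (n - r - 1)} \<xi>"
    \<comment> \<open>Restricting the definition to explicit pairs keeps \<open>three_polys\<close>
      folded, so that \<open>zero\<close> still applies.\<close>
    using zero[OF n] by (auto simp: common_zero_def[of "{_, _}"])
  have p7: "\<forall>n\<ge>r + 1. \<forall>\<xi>. double_common_zero (three_polys \<mu> \<mu>' r n) \<xi> \<longleftrightarrow>
      common_zero {cheb r, cheb n, cheb (n - r - 1)} \<xi>"
    unfolding double_common_zero_def
    using zero[OF n] double[OF n] by (auto simp: common_zero_def[of "{_, _, _}"])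
  have p9: "\<forall>n\<ge>r + 1.
      (odd n \<and> odd r \<longrightarrow> double_common_zero (three_polys \<mu> \<mu>' r n) 0) \<and>
      ((odd n \<and> even r) \<or> even n \<longrightarrow> \<not> common_zero (three_polys \<mu> \<mu>' r n) 0)"
    unfolding double_common_zero_def
    using zero[OF n] double[OF n] parity by (simp add: cheb_origin)
  show ?thesis
    using p1 p1' p2 p3 p4 p5 p6 p7 p9 by blast
qed

end
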